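(* Let $\alpha\in(0,1/2)$ be a prescribed error level. Consider testing $H_0:\mu=0$ against $H_1:\mu\in K,\ \|\mu\|_2\ge\rho$, where $K\subset\mathbb{R}^d$ is a QCO set, from $N$ samples of $\mathcal N(\mu,\sigma^2\mathbf I_d)$ under the strong $\epsilon$-contamination model. If $\epsilon\gtrsim\frac{1}{\sqrt N}$ and $\rho\lesssim\epsilon\sigma$, then $$\inf_{\phi\in A_s}\ \sup_{\mu\in K,\ \|\mu\|_2\ge\rho}\ \sup_{\mathcal C}\ \mathbb{P}_\mu\big(\phi(\mathcal C(\tilde{\mathbf X}))=0\big)=\Theta(1).$$ That is, there are positive constants $c_1,c_2,c_3$ (depending at most on $\alpha$) such that whenever $\epsilon\ge c_1/\sqrt N$ and $\rho\le c_2\epsilon\sigma$, the left-hand side is at least $c_3$.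
   Context: QCO set: $K\subset\mathbb{R}^d$ is quadratically convex orthosymmetric if (1) $K$ is convex; (2) $K^2:=\{(\theta_1^2,\dots,\theta_d^2)^\top:\theta\in K\}$ is convex; (3) $\theta\in K$ implies $(\eta_1\theta_1,\dots,\eta_d\theta_d)^\top\in K$ for all $\eta_i\in\{-1,1\}$. Model: $\tilde{\mathbf X}=\{\tilde X_1,\dots,\tilde X_N\}$ are i.i.d. $\mathcal N(\mu,\sigma^2\mathbf I_d)$ with unknown $\mu\in K$ and known $\sigma>0$; $\mathbb{P}_\mu$ is the probability law when the mean is $\mu$. Strong $\epsilon$-contamination: $\epsilon\in[0,c_0)$ is known, with $c_0<1/2$ a fixed small constant. An adversary $\mathcal C$ with full knowledge of the true distribution (and of $K$) inspects $\tilde{\mathbf X}$ and replaces up to $\epsilon N$ of the samples by arbitrary values (possibly randomly); only the resulting $\mathbf X=\mathcal C(\tilde{\mathbf X})$ is observed, and the set of corrupted indices is unknown. A test is a $\{0,1\}$-valued measurable function $\phi$ of the observed data, and $A_s=\{\phi:\sup_{\mathcal C}\mathbb{P}_0(\phi(\mathcal C(\tilde{\mathbf X}))=1)\le\alpha\}$. The alternative set $\{\mu\in K:\|\mu\|_2\ge\rho\}$ is understood to be nonempty. Standing assumption of the paper: $\sup_{\theta\in K}\|\theta\|_2>\sigma/\sqrt N$. *)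

theory Defs
  imports "HOL-Probability.Probability"
begin

text \<open>
  The dimension d varies inside the statement (the constants must not depend on it), so
  vectors of length d are functions in \<open>{..<d} \<rightarrow>\<^sub>E UNIV\<close>, which is the carrier of the
  library's product measure spaces. The library's notion of convexity needs a real vector space
  type and is therefore spelled out.
\<close>

type_synonym point = "nat \<Rightarrow> real"
type_synonym dataset = "nat \<Rightarrow> point"

definition l2_norm :: "nat \<Rightarrow> point \<Rightarrow> real" where
  "l2_norm d \<theta> = L2_set \<theta> {..<d}"

definition convex_pts :: "nat \<Rightarrow> point set \<Rightarrow> bool" where
  "convex_pts d S \<longleftrightarrow>
     (\<forall>x\<in>S. \<forall>y\<in>S. \<forall>u v. 0 \<le> u \<longrightarrow> 0 \<le> v \<longrightarrow> u + v = 1 \<longrightarrow>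
        (\<lambda>i\<in>{..<d}. u * x i + v * y i) \<in> S)"

definition square_set :: "nat \<Rightarrow> point set \<Rightarrow> point set" where
  "square_set d K = (\<lambda>\<theta>. \<lambda>i\<in>{..<d}. (\<theta> i)\<^sup>2) ` K"

definition qco :: "nat \<Rightarrow> point set \<Rightarrow> bool" where
  "qco d K \<longleftrightarrow>
     K \<subseteq> ({..<d} \<rightarrow>\<^sub>E UNIV) \<and>
     convex_pts d K \<and>
     convex_pts d (square_set d K) \<and>
     (\<forall>\<theta>\<in>K. \<forall>\<eta>. (\<forall>i<d. \<eta> i \<in> {-1, 1}) \<longrightarrow> (\<lambda>i\<in>{..<d}. \<eta> i * \<theta> i) \<in> K)"

definition data_space :: "nat \<Rightarrow> nat \<Rightarrow> dataset measure" where
  "data_space N d = (\<Pi>\<^sub>M j\<in>{..<N}. \<Pi>\<^sub>M i\<in>{..<d}. borel)"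

text \<open>
  The covariance matrix is a multiple of the identity, so the Gaussian law is the product of
  its one-dimensional marginals; note that \<open>normal_density\<close> takes the standard deviation.
\<close>

definition gaussian :: "nat \<Rightarrow> real \<Rightarrow> point \<Rightarrow> point measure" where
  "gaussian d \<sigma> \<mu> = (\<Pi>\<^sub>M i\<in>{..<d}. density lborel (\<lambda>x. ennreal (normal_density (\<mu> i) \<sigma> x)))"

definition sample_law :: "nat \<Rightarrow> nat \<Rightarrow> real \<Rightarrow> point \<Rightarrow> dataset measure" where
  "sample_law N d \<sigma> \<mu> = (\<Pi>\<^sub>M j\<in>{..<N}. gaussian d \<sigma> \<mu>)"

text \<open>
  A possibly randomized adversary is a Markov kernel: \<open>C x\<close> is the law of the observed data
  given the clean data x. Deterministic adversaries are the kernels \<open>\<lambda>x. return _ (f x)\<close>.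
  Its knowledge of the true mean, of K and of the test is expressed by taking suprema
  over C after these have been fixed.
\<close>

definition adversaries :: "nat \<Rightarrow> nat \<Rightarrow> real \<Rightarrow> (dataset \<Rightarrow> dataset measure) set" where
  "adversaries N d \<epsilon> =
     {C \<in> data_space N d \<rightarrow>\<^sub>M prob_algebra (data_space N d).
        \<forall>x\<in>space (data_space N d).
          AE y in C x. real (card {j\<in>{..<N}. y j \<noteq> x j}) \<le> \<epsilon> * real N}"

definition observed_law ::
    "nat \<Rightarrow> nat \<Rightarrow> real \<Rightarrow> point \<Rightarrow> (dataset \<Rightarrow> dataset measure) \<Rightarrow> dataset measure" where
  "observed_law N d \<sigma> \<mu> C = sample_law N d \<sigma> \<mu> \<bind> C"

definition prob_test ::
    "nat \<Rightarrow> nat \<Rightarrow> real \<Rightarrow> point \<Rightarrow> (dataset \<Rightarrow> dataset measure) \<Rightarrow> (dataset \<Rightarrow> nat) \<Rightarrow> nat \<Rightarrow> ennreal"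
  where
  "prob_test N d \<sigma> \<mu> C \<phi> b =
     emeasure (observed_law N d \<sigma> \<mu> C) {x \<in> space (data_space N d). \<phi> x = b}"

definition tests :: "nat \<Rightarrow> nat \<Rightarrow> (dataset \<Rightarrow> nat) set" where
  "tests N d = data_space N d \<rightarrow>\<^sub>M count_space {0, 1}"

definition strong_level_tests ::
    "nat \<Rightarrow> nat \<Rightarrow> real \<Rightarrow> real \<Rightarrow> real \<Rightarrow> (dataset \<Rightarrow> nat) set" where
  "strong_level_tests N d \<sigma> \<epsilon> \<alpha> =
     {\<phi> \<in> tests N d.
        (SUP C\<in>adversaries N d \<epsilon>. prob_test N d \<sigma> (\<lambda>i\<in>{..<d}. 0) C \<phi> 1) \<le> ennreal \<alpha>}"

definition alternative :: "nat \<Rightarrow> point set \<Rightarrow> real \<Rightarrow> point set" where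
  "alternative d K \<rho> = {\<mu> \<in> K. \<rho> \<le> l2_norm d \<mu>}"

definition minimax_type2 ::
    "nat \<Rightarrow> nat \<Rightarrow> real \<Rightarrow> point set \<Rightarrow> real \<Rightarrow> real \<Rightarrow> real \<Rightarrow> ennreal" where
  "minimax_type2 N d \<sigma> K \<epsilon> \<alpha> \<rho> =
     (INF \<phi>\<in>strong_level_tests N d \<sigma> \<epsilon> \<alpha>.
        SUP \<mu>\<in>alternative d K \<rho>.
          SUP C\<in>adversaries N d \<epsilon>. prob_test N d \<sigma> \<mu> C \<phi> 0)"

end

theory Submission
  imports Defs
begin

text \<open>
  A QCO set can be shrunk towards 0, so some \<open>\<mu>\<close> in the alternative has norm \<open>max 0 \<rho>\<close>. The laws
  of one sample under \<open>\<mu>\<close> and under 0 then have total variation distance at most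
  \<open>3 / 2 * t\<close> with \<open>t = c2 * \<epsilon>\<close>, by the chi-square divergence \<open>exp (\<parallel>\<mu>\<parallel>\<^sup>2 / \<sigma>\<^sup>2) - 1\<close>. They are coupled
  explicitly: x, drawn under \<open>\<mu>\<close>, is kept with probability \<open>min 1 (1 / r x)\<close>, where r is the likelihood
  ratio, and otherwise replaced by its reflection \<open>\<mu> - x\<close>. An adversary that applies this to every
  sample, and gives up when more than \<open>\<epsilon> * N\<close> samples would change, produces null data except with
  probability at most \<open>3 / 2 * c2\<close> by Markov's inequality, and on null data a test of level \<open>\<alpha>\<close>
  accepts with probability at least \<open>1 - \<alpha>\<close>.
\<close>

subsection \<open>Products of Markov kernels\<close>

text \<open>Only the factors indexed by \<open>I\<close> are assumed to be probability measures: in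
  the applications they are \<open>k (x i)\<close> for a point \<open>x\<close> of a product space,
  and outside \<open>I\<close> such a point carries no information.\<close>

lemma emeasure_PiM_PiE:
  assumes "finite I" and M: "\<And>i. i \<in> I \<Longrightarrow> prob_space (M i)"
    and A: "\<And>i. i \<in> I \<Longrightarrow> A i \<in> sets (M i)"
  shows "emeasure (PiM I M) (Pi\<^sub>E I A) = (\<Prod>i\<in>I. emeasure (M i) (A i))"
proof -
  have "prod_emb I M I (Pi\<^sub>E I A) = Pi\<^sub>E I A"
    using A by (intro prod_emb_PiE_same_index sets.sets_into_space) auto
  with emeasure_PiM_emb[of I M I A] assms show ?thesis by simp
qed

lemma nn_integral_PiM_component:
  assumes "\<And>i. i \<in> I \<Longrightarrow> prob_space (M i)" "j \<in> I" "f \<in> borel_measurable (M j)"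
  shows "(\<integral>\<^sup>+x. f (x j) \<partial>PiM I M) = (\<integral>\<^sup>+x. f x \<partial>M j)"
proof -
  have "(\<integral>\<^sup>+x. f x \<partial>M j) = (\<integral>\<^sup>+x. f x \<partial>distr (PiM I M) (M j) (\<lambda>x. x j))"
    using assms by (subst distr_PiM_component) auto
  also have "\<dots> = (\<integral>\<^sup>+x. f (x j) \<partial>PiM I M)"
    using assms by (subst nn_integral_distr) auto
  finally show ?thesis by simp
qed

lemma prob_algebra_kernelD:
  assumes "k \<in> M \<rightarrow>\<^sub>M prob_algebra L" "x \<in> space M"
  shows "prob_space (k x)" "sets (k x) = sets L" "space (k x) = space L"
  using measurable_space[OF assms] by (auto simp: space_prob_algebra dest: sets_eq_imp_space_eq)

text \<open>Rectangles form an intersection-stable generator, and the mass that the product kernel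
  gives to a rectangle is a finite product of functions, each measurable in a single
  coordinate.\<close>

lemma measurable_PiM_kernel:
  assumes I: "finite I" and k: "k \<in> M \<rightarrow>\<^sub>M prob_algebra L"
  shows "(\<lambda>x. PiM I (\<lambda>j. k (x j))) \<in> PiM I (\<lambda>_. M) \<rightarrow>\<^sub>M prob_algebra (PiM I (\<lambda>_. L))"
proof (rule measurable_prob_algebra_generated[OF sets_PiM Int_stable_prod_algebra prod_algebra_sets_into_space])
  fix x assume "x \<in> space (PiM I (\<lambda>_. M))"
  then have x: "x j \<in> space M" if "j \<in> I" for j
    using that by (auto simp: space_PiM)
  show "prob_space (PiM I (\<lambda>j. k (x j)))"
    using x by (intro prob_space_PiM prob_algebra_kernelD(1)[OF k])
  show "sets (PiM I (\<lambda>j. k (x j))) = sets (PiM I (\<lambda>_. L))"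
    using x by (intro sets_PiM_cong refl prob_algebra_kernelD(2)[OF k])
next
  fix A assume "A \<in> prod_algebra I (\<lambda>_. L)"
  then obtain E where A: "A = Pi\<^sub>E I E" and E: "\<And>i. i \<in> I \<Longrightarrow> E i \<in> sets L"
    by (auto elim!: prod_algebraE_all)
  have "(\<lambda>x. \<Prod>i\<in>I. emeasure (k (x i)) (E i)) \<in> borel_measurable (PiM I (\<lambda>_. M))"
  proof (intro borel_measurable_prod_ennreal)
    fix i assume i: "i \<in> I"
    show "(\<lambda>x. emeasure (k (x i)) (E i)) \<in> borel_measurable (PiM I (\<lambda>_. M))"
      by (rule measurable_compose[OF measurable_component_singleton[OF i]
            measurable_emeasure_kernel[OF measurable_prob_algebraD[OF k] E[OF i]]])
  qed
  also have "?this \<longleftrightarrow> (\<lambda>x. emeasure (PiM I (\<lambda>j. k (x j))) A) \<in> borel_measurable (PiM I (\<lambda>_. M))"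
    unfolding A
  proof (intro measurable_cong emeasure_PiM_PiE[symmetric] I)
    fix x i assume "x \<in> space (PiM I (\<lambda>_. M))" "i \<in> I"
    then have "x i \<in> space M" by (auto simp: space_PiM)
    then show "prob_space (k (x i))" "E i \<in> sets (k (x i))"
      using prob_algebra_kernelD[OF k] E \<open>i \<in> I\<close> by auto
  qed
  finally show "(\<lambda>x. emeasure (PiM I (\<lambda>j. k (x j))) A) \<in> borel_measurable (PiM I (\<lambda>_. M))" .
qed

text \<open>On a rectangle the integrand is a product of functions of separate coordinates, so its
  integral over the product law factorizes. This lets a coupling of one sample act on all samples at
  once.\<close>

lemma bind_PiM_kernel:
  assumes I: "finite I" and P: "P \<in> space (prob_algebra M)" and k: "k \<in> M \<rightarrow>\<^sub>M prob_algebra L"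
  shows "PiM I (\<lambda>_. P) \<bind> (\<lambda>x. PiM I (\<lambda>j. k (x j))) = PiM I (\<lambda>_. P \<bind> k)"
proof -
  have Pp: "prob_space P" and Ps[measurable_cong]: "sets P = sets M"
    using P by (auto simp: space_prob_algebra)
  have B: "prob_space (P \<bind> k)" "sets (P \<bind> k) = sets L"
    using prob_space_bind'[OF P k] sets_bind'[OF P k] by auto
  interpret P: product_sigma_finite "\<lambda>_. P"
    using Pp by (simp add: product_sigma_finite_def prob_space_imp_sigma_finite)
  interpret B: product_sigma_finite "\<lambda>_. P \<bind> k"
    using B by (simp add: product_sigma_finite_def prob_space_imp_sigma_finite)
  have PI: "PiM I (\<lambda>_. P) \<in> space (prob_algebra (PiM I (\<lambda>_. M)))"
    by (auto simp: space_prob_algebra intro!: prob_space_PiM Pp sets_PiM_cong Ps)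
  note K = measurable_PiM_kernel[OF I k]
  show ?thesis
  proof (rule B.PiM_eqI[OF I])
    show "sets (PiM I (\<lambda>_. P) \<bind> (\<lambda>x. PiM I (\<lambda>j. k (x j)))) = sets (PiM I (\<lambda>_. P \<bind> k))"
      using sets_bind'[OF PI K] B(2) by (simp cong: sets_PiM_cong)
    fix A assume A: "\<And>i. i \<in> I \<Longrightarrow> A i \<in> sets (P \<bind> k)"
    then have AL: "\<And>i. i \<in> I \<Longrightarrow> A i \<in> sets L" using B(2) by simp
    have "emeasure (PiM I (\<lambda>_. P) \<bind> (\<lambda>x. PiM I (\<lambda>j. k (x j)))) (Pi\<^sub>E I A)
        = (\<integral>\<^sup>+x. emeasure (PiM I (\<lambda>j. k (x j))) (Pi\<^sub>E I A) \<partial>PiM I (\<lambda>_. P))"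
      using AL I by (intro emeasure_bind_prob_algebra[OF PI K] sets_PiM_I_finite)
    also have "\<dots> = (\<integral>\<^sup>+x. (\<Prod>i\<in>I. emeasure (k (x i)) (A i)) \<partial>PiM I (\<lambda>_. P))"
    proof (intro nn_integral_cong emeasure_PiM_PiE I)
      fix x i assume "x \<in> space (PiM I (\<lambda>_. P))" "i \<in> I"
      then have "x i \<in> space M" using sets_eq_imp_space_eq[OF Ps] by (auto simp: space_PiM)
      then show "prob_space (k (x i))" "A i \<in> sets (k (x i))"
        using prob_algebra_kernelD[OF k] AL \<open>i \<in> I\<close> by auto
    qed
    also have "\<dots> = (\<Prod>i\<in>I. \<integral>\<^sup>+x. emeasure (k x) (A i) \<partial>P)"
      using measurable_emeasure_kernel[OF measurable_prob_algebraD[OF k] AL] I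
      by (intro P.product_nn_integral_prod) (auto cong: measurable_cong_sets simp: Ps)
    also have "\<dots> = (\<Prod>i\<in>I. emeasure (P \<bind> k) (A i))"
      by (intro prod.cong refl emeasure_bind_prob_algebra[OF P k, symmetric] AL)
    finally show "emeasure (PiM I (\<lambda>_. P) \<bind> (\<lambda>x. PiM I (\<lambda>j. k (x j)))) (Pi\<^sub>E I A)
        = (\<Prod>i\<in>I. emeasure (P \<bind> k) (A i))" .
  qed
qed

subsection \<open>A coupling by random reflection\<close>

text \<open>The accept-or-move step of the coupling, written as the image of a coin toss. Taking
  \<open>M\<close> as target gives all these laws the sigma-algebra of \<open>M\<close>.\<close>

definition flip_kernel :: "'a measure \<Rightarrow> ('a \<Rightarrow> real) \<Rightarrow> ('a \<Rightarrow> 'a) \<Rightarrow> 'a \<Rightarrow> 'a measure" where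
  "flip_kernel M a R x = distr (measure_pmf (bernoulli_pmf (a x))) M (\<lambda>b. if b then x else R x)"

lemma emeasure_flip_kernel:
  assumes "x \<in> space M" "R x \<in> space M" "0 \<le> a x" "a x \<le> 1" "A \<in> sets M"
  shows "emeasure (flip_kernel M a R x) A
       = indicator A x * ennreal (a x) + indicator A (R x) * ennreal (1 - a x)"
proof -
  have "emeasure (flip_kernel M a R x) A = (\<integral>\<^sup>+y. indicator A y \<partial>flip_kernel M a R x)"
    using assms by (subst nn_integral_indicator) (auto simp: flip_kernel_def)
  also have "\<dots> = (\<integral>\<^sup>+b. indicator A (if b then x else R x) \<partial>bernoulli_pmf (a x))"
    unfolding flip_kernel_def using assms by (subst nn_integral_distr) auto
  finally show ?thesis using assms by simp
qed

lemma measurable_flip_kernel: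
  assumes R: "R \<in> M \<rightarrow>\<^sub>M M" and a: "a \<in> borel_measurable M"
    and a01: "\<And>x. x \<in> space M \<Longrightarrow> 0 \<le> a x" "\<And>x. x \<in> space M \<Longrightarrow> a x \<le> 1"
  shows "flip_kernel M a R \<in> M \<rightarrow>\<^sub>M prob_algebra M"
proof (intro measurable_prob_algebraI measurable_subprob_algebra)
  note [measurable] = R a
  fix x assume x: "x \<in> space M"
  have Rx: "R x \<in> space M" using measurable_space[OF R x] .
  show "prob_space (flip_kernel M a R x)"
    unfolding flip_kernel_def using x Rx by (intro measure_pmf.prob_space_distr) auto
  then show "subprob_space (flip_kernel M a R x)" by (rule prob_space_imp_subprob_space)
  show "sets (flip_kernel M a R x) = sets M" by (simp add: flip_kernel_def)
next
  note [measurable] = R a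
  fix A assume [measurable]: "A \<in> sets M"
  have "(\<lambda>x. indicator A x * ennreal (a x) + indicator A (R x) * ennreal (1 - a x)) \<in> borel_measurable M"
    by measurable
  also have "?this \<longleftrightarrow> (\<lambda>x. emeasure (flip_kernel M a R x) A) \<in> borel_measurable M"
    using a01 measurable_space[OF R]
    by (intro measurable_cong emeasure_flip_kernel[symmetric]) auto
  finally show "(\<lambda>x. emeasure (flip_kernel M a R x) A) \<in> borel_measurable M" .
qed

lemma bind_flip_kernel:
  fixes r :: "'a \<Rightarrow> real"
  assumes Q: "sets Q = sets M" and P: "P = density Q (\<lambda>x. ennreal (r x))" "prob_space P"
    and R: "R \<in> M \<rightarrow>\<^sub>M M" "distr P M R = Q"
    and r: "r \<in> borel_measurable M" "\<And>x. x \<in> space M \<Longrightarrow> 0 < r x"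
      "\<And>x. x \<in> space M \<Longrightarrow> r (R x) = 1 / r x"
  shows "P \<bind> flip_kernel M (\<lambda>x. min 1 (1 / r x)) R = Q"
    \<comment> \<open>Relative to Q, the mass that stays has density \<open>min 1 r\<close> and the reflected mass fills
      exactly the remaining \<open>1 - min 1 r\<close>.\<close>
proof (rule measure_eqI)
  note [measurable] = R(1) r(1)
  note Q[measurable_cong]
  have sp[simp]: "space Q = space M" using Q by (rule sets_eq_imp_space_eq)
  let ?a = "\<lambda>x. min 1 (1 / r x)"
  have Ps: "sets P = sets M" "space P = space M" using Q by (auto simp: P(1))
  note Ps(1)[measurable_cong]
  have PA: "P \<in> space (prob_algebra M)" using P Ps by (simp add: space_prob_algebra)
  have k: "flip_kernel M ?a R \<in> M \<rightarrow>\<^sub>M prob_algebra M"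
    using r(2) by (intro measurable_flip_kernel) (auto intro: less_imp_le)
  show "sets (P \<bind> flip_kernel M ?a R) = sets Q"
    using sets_bind'[OF PA k] Q by simp
  fix A assume "A \<in> sets (P \<bind> flip_kernel M ?a R)"
  then have A[measurable]: "A \<in> sets M" using sets_bind'[OF PA k] by simp
  have Rs: "x \<in> space M \<Longrightarrow> R x \<in> space M" for x using measurable_space[OF R(1)] .
  have "emeasure (P \<bind> flip_kernel M ?a R) A = (\<integral>\<^sup>+x. emeasure (flip_kernel M ?a R x) A \<partial>P)"
    by (rule emeasure_bind_prob_algebra[OF PA k A])
  also have "\<dots> = (\<integral>\<^sup>+x. indicator A x * ennreal (?a x) + indicator A (R x) * ennreal (1 - ?a x) \<partial>P)"
    using r(2) Rs by (intro nn_integral_cong emeasure_flip_kernel) (auto simp: Ps intro: less_imp_le)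
  also have "\<dots> = (\<integral>\<^sup>+x. indicator A x * ennreal (?a x) \<partial>P) + (\<integral>\<^sup>+x. indicator A (R x) * ennreal (1 - ?a x) \<partial>P)"
    by (intro nn_integral_add) measurable
  also have "(\<integral>\<^sup>+x. indicator A x * ennreal (?a x) \<partial>P) = (\<integral>\<^sup>+x. indicator A x * ennreal (min 1 (r x)) \<partial>Q)"
    unfolding P(1)
  proof (subst nn_integral_density, measurable, intro nn_integral_cong)
    fix x assume "x \<in> space Q"
    then have "0 < r x" using r(2) by simp
    then have "r x * min 1 (1 / r x) = min 1 (r x)" by (auto simp: min_def field_simps)
    then show "ennreal (r x) * (indicator A x * ennreal (min 1 (1 / r x))) = indicator A x * ennreal (min 1 (r x))"
      using \<open>0 < r x\<close> by (simp add: ennreal_mult'[symmetric] mult.left_commute split: split_indicator)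
  qed
  \<comment> \<open>Since \<open>R\<close> inverts the ratio, the probability of reflection is a
    function of \<open>R x\<close> alone. The integral can then be moved along \<open>R\<close>,
    which carries \<open>P\<close> to \<open>Q\<close>.\<close>
  also have "(\<integral>\<^sup>+x. indicator A (R x) * ennreal (1 - ?a x) \<partial>P)
      = (\<integral>\<^sup>+x. indicator A (R x) * ennreal (1 - min 1 (r (R x))) \<partial>P)"
    using r(3) by (intro nn_integral_cong) (simp add: Ps)
  also have "\<dots> = (\<integral>\<^sup>+x. indicator A x * ennreal (1 - min 1 (r x)) \<partial>distr P M R)"
    by (subst nn_integral_distr) auto
  also have "\<dots> = (\<integral>\<^sup>+x. indicator A x * ennreal (1 - min 1 (r x)) \<partial>Q)"
    by (simp add: R(2))
  also have "(\<integral>\<^sup>+x. indicator A x * ennreal (min 1 (r x)) \<partial>Q)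
      + (\<integral>\<^sup>+x. indicator A x * ennreal (1 - min 1 (r x)) \<partial>Q)
      = (\<integral>\<^sup>+x. indicator A x * ennreal (min 1 (r x)) + indicator A x * ennreal (1 - min 1 (r x)) \<partial>Q)"
    by (intro nn_integral_add[symmetric]) measurable
  also have "\<dots> = (\<integral>\<^sup>+x. indicator A x \<partial>Q)"
    using r(2) by (intro nn_integral_cong)
      (auto simp: ennreal_plus[symmetric] less_imp_le simp del: ennreal_plus split: split_indicator)
  also have "\<dots> = emeasure Q A" using Q by simp
  finally show "emeasure (P \<bind> flip_kernel M ?a R) A = emeasure Q A" .
qed

text \<open>A point moves only if the coin says so, and the mean probability of this is the
  \<open>Q\<close>-integral of the positive part of \<open>r - 1\<close>, the total variation
  distance of \<open>P\<close> and \<open>Q\<close>. As \<open>r\<close> has \<open>Q\<close>-mean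
  1, \<open>s - 1\<close> is the chi-square divergence; the free parameter \<open>t\<close> balances
  the two terms of the bound.\<close>

lemma nn_integral_flip_kernel_changed:
  fixes r :: "'a \<Rightarrow> real"
  assumes Q: "sets Q = sets M" "prob_space Q" and P: "P = density Q (\<lambda>x. ennreal (r x))" "prob_space P"
    and R: "R \<in> M \<rightarrow>\<^sub>M M"
    and r: "r \<in> borel_measurable M" "\<And>x. x \<in> space M \<Longrightarrow> 0 < r x"
    and D: "\<And>x. x \<in> space M \<Longrightarrow> {y \<in> space M. y \<noteq> x} \<in> sets M"
    and t: "0 < t" and s: "(\<integral>\<^sup>+x. ennreal ((r x)\<^sup>2) \<partial>Q) = ennreal s" "0 \<le> s"
  shows "(\<integral>\<^sup>+x. emeasure (flip_kernel M (\<lambda>x. min 1 (1 / r x)) R x) {y \<in> space M. y \<noteq> x} \<partial>P)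
       \<le> ennreal ((s - 1) / (2 * t) + t / 2)"
proof -
  note [measurable] = R(1) r(1)
  note Q(1)[measurable_cong]
  interpret Q: prob_space Q by fact
  have sp[simp]: "space Q = space M" using Q(1) by (rule sets_eq_imp_space_eq)
  have Rs: "x \<in> space M \<Longrightarrow> R x \<in> space M" for x using measurable_space[OF R(1)] .
  let ?X = "\<integral>\<^sup>+x. ennreal (max 0 (r x - 1)) \<partial>Q"
  \<comment> \<open>The point \<open>x\<close> lies outside the set, so only the reflected mass
    counts. This is an inequality because \<open>R x\<close> may coincide with
    \<open>x\<close>.\<close>
  have "(\<integral>\<^sup>+x. emeasure (flip_kernel M (\<lambda>x. min 1 (1 / r x)) R x) {y \<in> space M. y \<noteq> x} \<partial>P)
      \<le> (\<integral>\<^sup>+x. ennreal (1 - min 1 (1 / r x)) \<partial>P)"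
    using r(2) Rs D
    by (intro nn_integral_mono, subst emeasure_flip_kernel)
       (auto simp: P(1) less_imp_le split: split_indicator)
  also have "\<dots> = ?X"
    unfolding P(1)
  proof (subst nn_integral_density, measurable, intro nn_integral_cong)
    fix x assume "x \<in> space Q"
    then have "0 < r x" using r(2) by simp
    then have "r x * (1 - min 1 (1 / r x)) = max 0 (r x - 1)" by (auto simp: min_def max_def field_simps)
    then show "ennreal (r x) * ennreal (1 - min 1 (1 / r x)) = ennreal (max 0 (r x - 1))"
      using \<open>0 < r x\<close> by (simp add: ennreal_mult'[symmetric])
  qed
  finally have 1: "(\<integral>\<^sup>+x. emeasure (flip_kernel M (\<lambda>x. min 1 (1 / r x)) R x) {y \<in> space M. y \<noteq> x} \<partial>P) \<le> ?X" .
  have r1: "(\<integral>\<^sup>+x. ennreal (r x) \<partial>Q) = 1"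
    using prob_space.emeasure_space_1[OF P(2)] 
    by (simp add: P(1) emeasure_density cong: nn_integral_cong_simp)
  \<comment> \<open>The summand \<open>1 / t\<close> makes room for the negative linear term of the
    expanded square: by \<open>r1\<close> it is the integral of \<open>r / t\<close>. It is
    subtracted again at the end.\<close>
  have "?X + ennreal (1 / t) = ?X + ennreal (1 / t) * (\<integral>\<^sup>+x. ennreal (r x) \<partial>Q)"
    by (simp add: r1)
  also have "\<dots> = (\<integral>\<^sup>+x. ennreal (max 0 (r x - 1)) + ennreal (1 / t) * ennreal (r x) \<partial>Q)"
    by (simp add: nn_integral_add nn_integral_cmult)
  also have "\<dots> \<le> (\<integral>\<^sup>+x. ennreal (1 / (2 * t)) * ennreal ((r x)\<^sup>2) + ennreal (1 / (2 * t) + t / 2) \<partial>Q)"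
  proof (intro nn_integral_mono)
    fix x assume "x \<in> space Q"
    then have r0: "0 < r x" using r(2) by simp
    \<comment> \<open>AM-GM, \<open>\<bar>r - 1\<bar> \<le> (r - 1)\<^sup>2 / (2 * t) + t / 2\<close>, expanded so that no negative terms are integrated.\<close>
    have "1 / (2 * t) * (r x)\<^sup>2 + (1 / (2 * t) + t / 2) - 1 / t * r x - (r x - 1)
        = (r x - 1 - t)\<^sup>2 / (2 * t)"
      using t by (simp add: field_simps power2_eq_square)
    moreover have "1 / (2 * t) * (r x)\<^sup>2 + (1 / (2 * t) + t / 2) - 1 / t * r x
        = (r x - 1)\<^sup>2 / (2 * t) + t / 2"
      using t by (simp add: field_simps power2_eq_square)
    moreover have "0 \<le> (r x - 1 - t)\<^sup>2 / (2 * t)" "0 \<le> (r x - 1)\<^sup>2 / (2 * t)"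
      using t by auto
    ultimately have "max 0 (r x - 1) + 1 / t * r x \<le> 1 / (2 * t) * (r x)\<^sup>2 + (1 / (2 * t) + t / 2)"
      using t by linarith
    then have le: "ennreal (max 0 (r x - 1) + 1 / t * r x)
        \<le> ennreal (1 / (2 * t) * (r x)\<^sup>2 + (1 / (2 * t) + t / 2))"
      by (rule ennreal_leI)
    have "ennreal (max 0 (r x - 1) + 1 / t * r x) = ennreal (max 0 (r x - 1)) + ennreal (1 / t) * ennreal (r x)"
      using r0 t by (subst ennreal_plus) (auto simp: ennreal_mult[symmetric])
    moreover have "ennreal (1 / (2 * t) * (r x)\<^sup>2 + (1 / (2 * t) + t / 2))
        = ennreal (1 / (2 * t)) * ennreal ((r x)\<^sup>2) + ennreal (1 / (2 * t) + t / 2)"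
      using t by (subst ennreal_plus) (auto simp: ennreal_mult[symmetric] simp del: ennreal_plus)
    ultimately show "ennreal (max 0 (r x - 1)) + ennreal (1 / t) * ennreal (r x)
        \<le> ennreal (1 / (2 * t)) * ennreal ((r x)\<^sup>2) + ennreal (1 / (2 * t) + t / 2)"
      using le by simp
  qed
  also have "\<dots> = ennreal (1 / (2 * t)) * ennreal s + ennreal (1 / (2 * t) + t / 2)"
    by (simp add: nn_integral_add nn_integral_cmult s(1) Q.emeasure_space_1[unfolded sp] del: ennreal_plus)
  also have "\<dots> = ennreal (s / (2 * t) + (1 / (2 * t) + t / 2))"
    using t s(2) by (simp add: ennreal_mult'[symmetric] ennreal_plus[symmetric] del: ennreal_plus)
  finally have "?X + ennreal (1 / t) \<le> ennreal (s / (2 * t) + (1 / (2 * t) + t / 2))" .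
  then have "?X + ennreal (1 / t) - ennreal (1 / t) \<le> ennreal (s / (2 * t) + (1 / (2 * t) + t / 2)) - ennreal (1 / t)"
    by (rule ennreal_minus_mono) simp
  also have "\<dots> = ennreal ((s - 1) / (2 * t) + t / 2)"
  proof -
    have "1 / t = 1 / (2 * t) + 1 / (2 * t)" by simp
    then have "s / (2 * t) + (1 / (2 * t) + t / 2) - 1 / t = (s - 1) / (2 * t) + t / 2"
      unfolding diff_divide_distrib by linarith
    then show ?thesis using t by (simp only: ennreal_minus zero_le_divide_1_iff less_imp_le)
  qed
  finally have "?X \<le> ennreal ((s - 1) / (2 * t) + t / 2)" by simp
  with 1 show ?thesis by (rule order_trans)
qed

subsection \<open>From sample-wise couplings to adversaries\<close>

text \<open>The fallback is all or nothing: over budget, the clean data \<open>x\<close> comes back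
  untouched. Hence the budget is respected for every \<open>y\<close>, as an adversary must, and not
  merely with high probability.\<close>

definition truncate_changes :: "nat \<Rightarrow> real \<Rightarrow> (nat \<Rightarrow> 'a) \<Rightarrow> (nat \<Rightarrow> 'a) \<Rightarrow> nat \<Rightarrow> 'a" where
  "truncate_changes N m x y = (if real (card {j\<in>{..<N}. y j \<noteq> x j}) \<le> m then y else x)"

lemma truncate_changes_card:
  "0 \<le> m \<Longrightarrow> real (card {j\<in>{..<N}. truncate_changes N m x y j \<noteq> x j}) \<le> m"
  by (simp add: truncate_changes_def)

text \<open>Serves to derive measurability of the number of changes from that of the single
  comparisons, and to bring in Markov's inequality.\<close>

lemma card_eq_sum_if:
  "real (card {j\<in>{..<N::nat}. P j}) = (\<Sum>j<N. if P j then 1 else 0)"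
  by (simp add: sum.If_cases Int_def)

text \<open>Joint measurability in the clean and the proposed data is what turns truncation into a
  kernel. The comparison of two samples is assumed measurable, since the diagonal of a general
  measurable space need not be.\<close>

lemma measurable_truncate_changes:
  assumes D: "Measurable.pred (S \<Otimes>\<^sub>M S) (\<lambda>(x, y). y \<noteq> x)"
  shows "(\<lambda>(x, y). truncate_changes N m x y)
    \<in> PiM {..<N} (\<lambda>_. S) \<Otimes>\<^sub>M PiM {..<N} (\<lambda>_. S) \<rightarrow>\<^sub>M PiM {..<N} (\<lambda>_. S)"
proof -
  have [measurable]: "Measurable.pred (PiM {..<N} (\<lambda>_. S) \<Otimes>\<^sub>M PiM {..<N} (\<lambda>_. S)) (\<lambda>p. snd p j \<noteq> fst p j)"
    if "j \<in> {..<N}" for j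
  proof -
    have "(\<lambda>p. (fst p j, snd p j)) \<in> PiM {..<N} (\<lambda>_. S) \<Otimes>\<^sub>M PiM {..<N} (\<lambda>_. S) \<rightarrow>\<^sub>M S \<Otimes>\<^sub>M S"
      using that by measurable
    from measurable_compose[OF this D] show ?thesis by simp
  qed
  show ?thesis
    unfolding truncate_changes_def card_eq_sum_if case_prod_beta by measurable
qed

text \<open>For fixed clean data \<open>x\<close>, this is the event in the budget condition on
  adversaries; its measurability is needed to evaluate that condition under \<open>return\<close>
  and \<open>distr\<close>.\<close>

lemma sets_few_changes:
  fixes N :: nat
  assumes D: "Measurable.pred (S \<Otimes>\<^sub>M S) (\<lambda>(x, y). y \<noteq> x)" and x: "x \<in> space (PiM {..<N} (\<lambda>_. S))"
  shows "{y \<in> space (PiM {..<N} (\<lambda>_. S)). real (card {j\<in>{..<N}. y j \<noteq> x j}) \<le> m} \<in> sets (PiM {..<N} (\<lambda>_. S))"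
proof -
  have [measurable]: "Measurable.pred (PiM {..<N} (\<lambda>_. S)) (\<lambda>y. y j \<noteq> x j)" if j: "j \<in> {..<N}" for j
  proof -
    have "x j \<in> space S" using x j by (auto simp: space_PiM)
    then have "(\<lambda>y. (x j, y j)) \<in> PiM {..<N} (\<lambda>_. S) \<rightarrow>\<^sub>M S \<Otimes>\<^sub>M S"
      using j by measurable
    from measurable_compose[OF this D] show ?thesis by simp
  qed
  have "(\<lambda>y. \<Sum>j<N. if y j \<noteq> x j then 1 else 0 :: real) \<in> borel_measurable (PiM {..<N} (\<lambda>_. S))"
    by (intro borel_measurable_sum) measurable
  then show ?thesis unfolding card_eq_sum_if by (rule borel_measurable_le) (rule borel_measurable_const)
qed

text \<open>Without truncation the kernels would produce exactly the product of
  \<open>P \<bind> k\<close>. Truncation interferes only if more than \<open>m\<close> samples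
  change, and Markov's inequality bounds the probability of this by the expected number of changes,
  at most \<open>N * \<delta>\<close>, over \<open>m\<close>.\<close>

lemma contamination_bound:
  assumes P: "P \<in> space (prob_algebra S)" and k: "k \<in> S \<rightarrow>\<^sub>M prob_algebra S"
    and D: "Measurable.pred (S \<Otimes>\<^sub>M S) (\<lambda>(x, y). y \<noteq> x)"
    and \<delta>: "(\<integral>\<^sup>+x. emeasure (k x) {y \<in> space S. y \<noteq> x} \<partial>P) \<le> ennreal \<delta>" "0 \<le> \<delta>"
    and m: "0 < m"
    and A: "A \<in> sets (PiM {..<N} (\<lambda>_. S))"
  defines "C \<equiv> \<lambda>x. distr (PiM {..<N} (\<lambda>j. k (x j))) (PiM {..<N} (\<lambda>_. S)) (truncate_changes N m x)"
  shows "C \<in> PiM {..<N} (\<lambda>_. S) \<rightarrow>\<^sub>M prob_algebra (PiM {..<N} (\<lambda>_. S))" (is ?C)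
    and "emeasure (PiM {..<N} (\<lambda>_. P \<bind> k)) A
      \<le> emeasure (PiM {..<N} (\<lambda>_. P) \<bind> C) A + ennreal (real N * \<delta> / m)" (is ?le)
proof -
  let ?S = "PiM {..<N} (\<lambda>_. S)" and ?P = "PiM {..<N} (\<lambda>_. P)"
  let ?K = "\<lambda>x. PiM {..<N} (\<lambda>j. k (x j))"
  note K = measurable_PiM_kernel[OF finite_lessThan k, of N]
  note T = measurable_truncate_changes[OF D, of N m]
  show C: ?C
    unfolding C_def by (rule measurable_distr_prob_space2[OF K T])
  have Pp: "prob_space P" and Ps[measurable_cong]: "sets P = sets S"
    using P by (auto simp: space_prob_algebra)
  have PA: "?P \<in> space (prob_algebra ?S)"
    by (auto simp: space_prob_algebra intro!: prob_space_PiM Pp sets_PiM_cong Ps)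
  have spP: "space ?P = space ?S"
    using PA by (auto simp: space_prob_algebra dest: sets_eq_imp_space_eq)
  define g where "g x = emeasure (k x) {y \<in> space S. y \<noteq> x}" for x
  have Sig: "(SIGMA x:space S. {y \<in> space S. y \<noteq> x}) \<in> sets (S \<Otimes>\<^sub>M S)"
  proof -
    have "{p \<in> space (S \<Otimes>\<^sub>M S). case p of (x, y) \<Rightarrow> y \<noteq> x} \<in> sets (S \<Otimes>\<^sub>M S)"
      using D by (simp add: pred_def)
    also have "{p \<in> space (S \<Otimes>\<^sub>M S). case p of (x, y) \<Rightarrow> y \<noteq> x} = (SIGMA x:space S. {y \<in> space S. y \<noteq> x})"
      by (auto simp: space_pair_measure)
    finally show ?thesis .
  qed
  have Dx: "{y \<in> space S. y \<noteq> x} \<in> sets S" if "x \<in> space S" for x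
  proof -
    have "Pair x -` (SIGMA x:space S. {y \<in> space S. y \<noteq> x}) = {y \<in> space S. y \<noteq> x}"
      using that by auto
    with sets_Pair1[OF Sig, of x] show ?thesis by simp
  qed
  have g: "g \<in> borel_measurable S"
    unfolding g_def by (rule emeasure_measurable_subprob_algebra2[OF Sig measurable_prob_algebraD[OF k]])
  have g_comp: "(\<lambda>x. g (x j)) \<in> borel_measurable ?P" if "j < N" for j
    using that g by (intro measurable_compose[OF measurable_component_singleton]) 
      (auto simp: measurable_cong_sets[OF Ps refl])
  \<comment> \<open>Markov's inequality conditionally on the clean data \<open>x\<close>; here
    \<open>g (x j)\<close> is the probability that sample \<open>j\<close> changes. Averaging over
    \<open>x\<close> comes afterwards.\<close>
  have step: "emeasure (?K x) A \<le> emeasure (C x) A + ennreal (1 / m) * (\<Sum>j<N. g (x j))"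
    if x: "x \<in> space ?S" for x
  proof -
    have xj: "x j \<in> space S" if "j < N" for j using x that by (auto simp: space_PiM)
    have Ks: "sets (?K x) = sets ?S" "space (?K x) = space ?S"
      using prob_algebra_kernelD[OF K x] by auto
    have kj: "prob_space (k (x j))" "sets (k (x j)) = sets S" "space (k (x j)) = space S" if "j < N" for j
      using prob_algebra_kernelD[OF k xj[OF that]] by auto
    have Tx: "truncate_changes N m x \<in> ?S \<rightarrow>\<^sub>M ?S"
      using measurable_compose[OF measurable_Pair1'[OF x] T] by simp
    have Tx': "truncate_changes N m x \<in> ?K x \<rightarrow>\<^sub>M ?S"
      using Tx by (simp add: measurable_cong_sets[OF Ks(1) refl])
    define E where "E = truncate_changes N m x -` A \<inter> space (?K x)"
    have E: "E \<in> sets (?K x)" unfolding E_def by (rule measurable_sets[OF Tx' A])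
    have CE: "emeasure (C x) A = emeasure (?K x) E"
      unfolding C_def E_def by (rule emeasure_distr[OF Tx' A])
    have ind: "(\<lambda>y. indicator {z \<in> space S. z \<noteq> x j} (y j) :: ennreal) \<in> borel_measurable (?K x)"
      if "j < N" for j
      using that Dx[OF xj[OF that]] kj(2)[OF that]
      by (intro measurable_compose[OF measurable_component_singleton] borel_measurable_indicator) auto
    have "emeasure (?K x) A = (\<integral>\<^sup>+y. indicator A y \<partial>?K x)" using A Ks by simp
    also have "\<dots> \<le> (\<integral>\<^sup>+y. indicator E y + ennreal (1 / m) * (\<Sum>j<N. indicator {z \<in> space S. z \<noteq> x j} (y j)) \<partial>?K x)"
    proof (intro nn_integral_mono)
      fix y assume "y \<in> space (?K x)"
      then have y: "y \<in> space ?S" "y \<in> space (?K x)" using Ks by auto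
      have sum: "(\<Sum>j<N. indicator {z \<in> space S. z \<noteq> x j} (y j)) = ennreal (real (card {j\<in>{..<N}. y j \<noteq> x j}))"
      proof -
        have "(\<Sum>j<N. indicator {z \<in> space S. z \<noteq> x j} (y j)) = (\<Sum>j<N. ennreal (if y j \<noteq> x j then 1 else 0))"
          using y(1) by (intro sum.cong) (auto simp: space_PiM split: split_indicator)
        also have "\<dots> = ennreal (real (card {j\<in>{..<N}. y j \<noteq> x j}))"
          unfolding card_eq_sum_if by (rule sum_ennreal) auto
        finally show ?thesis .
      qed
      show "indicator A y \<le> indicator E y + ennreal (1 / m) * (\<Sum>j<N. indicator {z \<in> space S. z \<noteq> x j} (y j))"
      \<comment> \<open>Within budget truncation leaves \<open>y\<close> alone, so \<open>A\<close>
        and \<open>E\<close> agree at \<open>y\<close>. Over budget the number of changes divided by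
        \<open>m\<close> already exceeds 1.\<close>
      proof (cases "real (card {j\<in>{..<N}. y j \<noteq> x j}) \<le> m")
        case True
        then have "y \<in> A \<Longrightarrow> y \<in> E" using y by (simp add: E_def truncate_changes_def)
        then show ?thesis by (auto split: split_indicator)
      next
        case False
        then have "1 \<le> ennreal (1 / m * real (card {j\<in>{..<N}. y j \<noteq> x j}))"
          using m by (simp add: field_simps)
        also have "\<dots> = ennreal (1 / m) * (\<Sum>j<N. indicator {z \<in> space S. z \<noteq> x j} (y j))"
          unfolding sum using m by (subst ennreal_mult[symmetric]) auto
        finally have "1 \<le> ennreal (1 / m) * (\<Sum>j<N. indicator {z \<in> space S. z \<noteq> x j} (y j))" .
        then show ?thesis by (auto split: split_indicator intro: add_increasing)
      qed
    qed
    also have "\<dots> = (\<integral>\<^sup>+y. indicator E y \<partial>?K x)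
        + ennreal (1 / m) * (\<Sum>j<N. \<integral>\<^sup>+y. indicator {z \<in> space S. z \<noteq> x j} (y j) \<partial>?K x)"
    proof -
      have "(\<lambda>y. \<Sum>j<N. indicator {z \<in> space S. z \<noteq> x j} (y j) :: ennreal) \<in> borel_measurable (?K x)"
        by (intro borel_measurable_sum ind) auto
      moreover have "(\<integral>\<^sup>+y. (\<Sum>j<N. indicator {z \<in> space S. z \<noteq> x j} (y j)) \<partial>?K x)
          = (\<Sum>j<N. \<integral>\<^sup>+y. indicator {z \<in> space S. z \<noteq> x j} (y j) \<partial>?K x)"
        by (intro nn_integral_sum ind) auto
      ultimately show ?thesis using E by (simp add: nn_integral_add nn_integral_cmult)
    qed
    also have "(\<integral>\<^sup>+y. indicator E y \<partial>?K x) = emeasure (C x) A" using E CE by simp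
    also have "(\<Sum>j<N. \<integral>\<^sup>+y. indicator {z \<in> space S. z \<noteq> x j} (y j) \<partial>?K x) = (\<Sum>j<N. g (x j))"
    proof (intro sum.cong refl)
      fix j assume "j \<in> {..<N}"
      then have j: "j < N" by simp
      have "(\<integral>\<^sup>+y. indicator {z \<in> space S. z \<noteq> x j} (y j) \<partial>?K x) = (\<integral>\<^sup>+z. indicator {z \<in> space S. z \<noteq> x j} z \<partial>k (x j))"
        using kj Dx[OF xj[OF j]] j
        by (intro nn_integral_PiM_component borel_measurable_indicator) auto
      also have "\<dots> = g (x j)" unfolding g_def using kj(2)[OF j] Dx[OF xj[OF j]] by simp
      finally show "(\<integral>\<^sup>+y. indicator {z \<in> space S. z \<noteq> x j} (y j) \<partial>?K x) = g (x j)" .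
    qed
    finally show ?thesis .
  qed
  have CA: "(\<lambda>x. emeasure (C x) A) \<in> borel_measurable ?P"
    using measurable_emeasure_kernel[OF measurable_prob_algebraD[OF C] A] PA
    by (simp add: space_prob_algebra cong: measurable_cong_sets)
  have "emeasure (PiM {..<N} (\<lambda>_. P \<bind> k)) A = emeasure (?P \<bind> ?K) A"
    by (simp add: bind_PiM_kernel[OF finite_lessThan P k])
  also have "\<dots> = (\<integral>\<^sup>+x. emeasure (?K x) A \<partial>?P)"
    by (rule emeasure_bind_prob_algebra[OF PA K A])
  also have "\<dots> \<le> (\<integral>\<^sup>+x. emeasure (C x) A + ennreal (1 / m) * (\<Sum>j<N. g (x j)) \<partial>?P)"
    using step by (intro nn_integral_mono) (simp add: spP)
  also have "\<dots> = (\<integral>\<^sup>+x. emeasure (C x) A \<partial>?P) + ennreal (1 / m) * (\<Sum>j<N. \<integral>\<^sup>+x. g (x j) \<partial>?P)"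
  proof -
    have "(\<lambda>x. \<Sum>j<N. g (x j)) \<in> borel_measurable ?P"
      by (intro borel_measurable_sum g_comp) auto
    moreover have "(\<integral>\<^sup>+x. (\<Sum>j<N. g (x j)) \<partial>?P) = (\<Sum>j<N. \<integral>\<^sup>+x. g (x j) \<partial>?P)"
      by (intro nn_integral_sum g_comp) auto
    ultimately show ?thesis using CA by (simp add: nn_integral_add nn_integral_cmult)
  qed
  also have "(\<Sum>j<N. \<integral>\<^sup>+x. g (x j) \<partial>?P) = (\<Sum>j<N. \<integral>\<^sup>+x. g x \<partial>P)"
    using g Pp by (intro sum.cong refl nn_integral_PiM_component) (auto simp: measurable_cong_sets[OF Ps refl])
  also have "ennreal (1 / m) * (\<Sum>j<N. \<integral>\<^sup>+x. g x \<partial>P) \<le> ennreal (1 / m) * (\<Sum>j<N. ennreal \<delta>)"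
    using \<delta> by (intro mult_left_mono sum_mono) (auto simp: g_def)
  also have "\<dots> = ennreal (real N * \<delta> / m)"
    using m \<delta>(2) by (simp add: ennreal_of_nat_eq_real_of_nat ennreal_mult[symmetric])
  also have "(\<integral>\<^sup>+x. emeasure (C x) A \<partial>?P) = emeasure (?P \<bind> C) A"
    by (rule emeasure_bind_prob_algebra[OF PA C A, symmetric])
  finally show ?le by (simp add: add_left_mono)
qed

subsection \<open>Gaussian laws with close means\<close>

abbreviation normal_measure :: "real \<Rightarrow> real \<Rightarrow> real measure" where
  "normal_measure m s \<equiv> density lborel (\<lambda>x. ennreal (normal_density m s x))"

text \<open>The likelihood ratio of the normal law with mean \<open>m\<close> against the centred
  one, both with standard deviation \<open>s\<close>.\<close>

definition normal_ratio :: "real \<Rightarrow> real \<Rightarrow> real \<Rightarrow> real" where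
  "normal_ratio s m x = exp ((2 * x * m - m\<^sup>2) / (2 * s\<^sup>2))"

lemma measurable_normal_ratio[measurable]: "normal_ratio s m \<in> borel_measurable borel"
  unfolding normal_ratio_def by measurable

lemma normal_ratio_pos: "0 < normal_ratio s m x"
  by (simp add: normal_ratio_def)

lemma normal_density_shift:
  assumes "0 < s"
  shows "normal_density m s x = normal_density 0 s x * normal_ratio s m x"
proof -
  have "- (x - m)\<^sup>2 / (2 * s\<^sup>2) = - x\<^sup>2 / (2 * s\<^sup>2) + (2 * x * m - m\<^sup>2) / (2 * s\<^sup>2)"
    using assms by (simp add: field_simps power2_eq_square)
  then show ?thesis by (simp add: normal_density_def normal_ratio_def flip: exp_add)
qed

text \<open>Squaring the ratio doubles the mean in the exponent, up to a constant factor. The second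
  moment is then this factor times the total mass of a normal law, and no integral has to be
  computed.\<close>

lemma normal_density_ratio_square:
  assumes "0 < s"
  shows "normal_density 0 s x * (normal_ratio s m x)\<^sup>2 = exp (m\<^sup>2 / s\<^sup>2) * normal_density (2 * m) s x"
proof -
  have "(normal_ratio s m x)\<^sup>2 = exp (m\<^sup>2 / s\<^sup>2) * normal_ratio s (2 * m) x"
    using assms unfolding normal_ratio_def exp_add[symmetric] power2_eq_square[of "exp _"]
    by (simp add: field_simps power2_eq_square)
  then show ?thesis using normal_density_shift[OF assms, of "2 * m" x] by simp
qed

lemma prob_space_normal_measure: "0 < s \<Longrightarrow> prob_space (normal_measure m s)"
  by (rule prob_space_normal_density)

lemma normal_measure_eq_density:
  assumes "0 < s"
  shows "normal_measure m s = density (normal_measure 0 s) (\<lambda>x. ennreal (normal_ratio s m x))"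
  using normal_ratio_pos[of s m]
  by (simp add: density_density_eq normal_density_shift[OF assms, of m] ennreal_mult')

lemma nn_integral_normal_ratio_square:
  assumes "0 < s"
  shows "(\<integral>\<^sup>+x. ennreal ((normal_ratio s m x)\<^sup>2) \<partial>normal_measure 0 s) = ennreal (exp (m\<^sup>2 / s\<^sup>2))"
proof -
  have "(\<integral>\<^sup>+x. ennreal ((normal_ratio s m x)\<^sup>2) \<partial>normal_measure 0 s)
      = (\<integral>\<^sup>+x. ennreal (exp (m\<^sup>2 / s\<^sup>2)) * ennreal (normal_density (2 * m) s x) \<partial>lborel)"
    by (subst nn_integral_density)
       (auto simp: normal_density_ratio_square[OF assms] ennreal_mult[symmetric])
  also have "\<dots> = ennreal (exp (m\<^sup>2 / s\<^sup>2)) * emeasure (normal_measure (2 * m) s) (space (normal_measure (2 * m) s))"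
    by (simp add: nn_integral_cmult emeasure_density)
  finally show ?thesis
    using prob_space.emeasure_space_1[OF prob_space_normal_measure[OF assms]] by simp
qed

text \<open>An affine map with slope -1 and intercept \<open>m\<close> keeps the standard deviation
  and sends the mean to \<open>m - m\<close>.\<close>

lemma distr_normal_measure_reflect:
  assumes "0 < s"
  shows "distr (normal_measure m s) borel (\<lambda>x. m - x) = normal_measure 0 s"
proof -
  interpret prob_space "normal_measure m s" by (rule prob_space_normal_measure[OF assms])
  have "distributed (normal_measure m s) lborel (\<lambda>x. x) (\<lambda>x. ennreal (normal_density m s x))"
    by (auto simp: distributed_def distr_id2)
  from normal_density_affine[OF this assms, of "-1" m]
  have "distr (normal_measure m s) lborel (\<lambda>x. m - x) = normal_measure 0 s"
    by (simp add: distributed_def)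
  also have "distr (normal_measure m s) lborel (\<lambda>x. m - x) = distr (normal_measure m s) borel (\<lambda>x. m - x)"
    by (rule distr_cong) auto
  finally show ?thesis .
qed

section \<open>Gaussian vectors with independent coordinates\<close>

abbreviation point_space :: "nat \<Rightarrow> point measure" where
  "point_space d \<equiv> PiM {..<d} (\<lambda>_. borel)"

lemma sets_gaussian: "sets (gaussian d s \<mu>) = sets (point_space d)"
  unfolding gaussian_def by (intro sets_PiM_cong) auto

lemma prob_space_gaussian: "0 < s \<Longrightarrow> prob_space (gaussian d s \<mu>)"
  unfolding gaussian_def by (intro prob_space_PiM prob_space_normal_measure)

lemma gaussian_in_prob_algebra: "0 < s \<Longrightarrow> gaussian d s \<mu> \<in> space (prob_algebra (point_space d))"
  by (simp add: space_prob_algebra sets_gaussian prob_space_gaussian)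

lemma gaussian_zero: "gaussian d s (\<lambda>i\<in>{..<d}. 0) = PiM {..<d} (\<lambda>_. normal_measure 0 s)"
  unfolding gaussian_def by (intro PiM_cong) auto

definition gaussian_ratio :: "nat \<Rightarrow> real \<Rightarrow> point \<Rightarrow> point \<Rightarrow> real" where
  "gaussian_ratio d s \<mu> x = (\<Prod>i<d. normal_ratio s (\<mu> i) (x i))"

lemma measurable_gaussian_ratio[measurable]: "gaussian_ratio d s \<mu> \<in> borel_measurable (point_space d)"
  unfolding gaussian_ratio_def by measurable

lemma gaussian_ratio_pos: "0 < gaussian_ratio d s \<mu> x"
  unfolding gaussian_ratio_def by (intro prod_pos) (simp add: normal_ratio_pos)

text \<open>It suffices to compare rectangles. There the integral of the product of the coordinate
  ratios splits, and each factor is the one-dimensional change of density.\<close>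

lemma gaussian_eq_density:
  assumes s: "0 < s"
  shows "gaussian d s \<mu> = density (gaussian d s (\<lambda>i\<in>{..<d}. 0)) (\<lambda>x. ennreal (gaussian_ratio d s \<mu> x))"
proof -
  interpret P: product_sigma_finite "\<lambda>i. normal_measure (\<mu> i) s"
    using prob_space_normal_measure[OF s] by (simp add: product_sigma_finite_def prob_space_imp_sigma_finite)
  interpret Q: product_sigma_finite "\<lambda>_::nat. normal_measure 0 s"
    using prob_space_normal_measure[OF s] by (simp add: product_sigma_finite_def prob_space_imp_sigma_finite)
  let ?Q = "PiM {..<d} (\<lambda>_. normal_measure 0 s)"
  have Qs[measurable_cong]: "sets ?Q = sets (point_space d)" by (intro sets_PiM_cong) auto
  have "density ?Q (\<lambda>x. ennreal (gaussian_ratio d s \<mu> x)) = PiM {..<d} (\<lambda>i. normal_measure (\<mu> i) s)"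
  proof (rule P.PiM_eqI)
    show "sets (density ?Q (\<lambda>x. ennreal (gaussian_ratio d s \<mu> x))) = sets (PiM {..<d} (\<lambda>i. normal_measure (\<mu> i) s))"
      unfolding sets_density Qs by (intro sets_PiM_cong) auto
    fix A assume "\<And>i. i \<in> {..<d} \<Longrightarrow> A i \<in> sets (normal_measure (\<mu> i) s)"
    then have A: "\<And>i. i < d \<Longrightarrow> A i \<in> sets borel" by auto
    have AE: "Pi\<^sub>E {..<d} A \<in> sets ?Q" using A by (intro sets_PiM_I_finite) auto
    have "emeasure (density ?Q (\<lambda>x. ennreal (gaussian_ratio d s \<mu> x))) (Pi\<^sub>E {..<d} A)
        = (\<integral>\<^sup>+x. ennreal (gaussian_ratio d s \<mu> x) * indicator (Pi\<^sub>E {..<d} A) x \<partial>?Q)"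
      using AE by (intro emeasure_density) simp_all
    also have "\<dots> = (\<integral>\<^sup>+x. (\<Prod>i<d. ennreal (normal_ratio s (\<mu> i) (x i)) * indicator (A i) (x i)) \<partial>?Q)"
    proof (intro nn_integral_cong)
      fix x assume "x \<in> space ?Q"
      then have "indicator (Pi\<^sub>E {..<d} A) x = (\<Prod>i<d. indicator (A i) (x i) :: ennreal)"
        by (auto simp: space_PiM PiE_iff split: split_indicator)
      then show "ennreal (gaussian_ratio d s \<mu> x) * indicator (Pi\<^sub>E {..<d} A) x
          = (\<Prod>i<d. ennreal (normal_ratio s (\<mu> i) (x i)) * indicator (A i) (x i))"
        unfolding gaussian_ratio_def
        by (simp add: prod.distrib prod_ennreal less_imp_le[OF normal_ratio_pos])
    qed
    also have "\<dots> = (\<Prod>i<d. \<integral>\<^sup>+x. ennreal (normal_ratio s (\<mu> i) x) * indicator (A i) x \<partial>normal_measure 0 s)"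
      using A by (intro Q.product_nn_integral_prod) auto
    also have "\<dots> = (\<Prod>i<d. emeasure (normal_measure (\<mu> i) s) (A i))"
      using A by (intro prod.cong refl)
        (subst normal_measure_eq_density[OF s], subst emeasure_density, auto)
    finally show "emeasure (density ?Q (\<lambda>x. ennreal (gaussian_ratio d s \<mu> x))) (Pi\<^sub>E {..<d} A)
        = (\<Prod>i\<in>{..<d}. emeasure (normal_measure (\<mu> i) s) (A i))" .
  qed simp
  then show ?thesis unfolding gaussian_zero by (simp add: gaussian_def)
qed

text \<open>By independence the coordinate second moments multiply, so their exponents add up to the
  squared norm. The dimension enters through this norm only, which keeps the final constants free of
  \<open>d\<close>.\<close>

lemma nn_integral_gaussian_ratio_square:
  assumes s: "0 < s"
  shows "(\<integral>\<^sup>+x. ennreal ((gaussian_ratio d s \<mu> x)\<^sup>2) \<partial>gaussian d s (\<lambda>i\<in>{..<d}. 0))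
    = ennreal (exp ((l2_norm d \<mu> / s)\<^sup>2))"
proof -
  interpret Q: product_sigma_finite "\<lambda>_::nat. normal_measure 0 s"
    using prob_space_normal_measure[OF s] by (simp add: product_sigma_finite_def prob_space_imp_sigma_finite)
  have "(\<integral>\<^sup>+x. ennreal ((gaussian_ratio d s \<mu> x)\<^sup>2) \<partial>gaussian d s (\<lambda>i\<in>{..<d}. 0))
      = (\<integral>\<^sup>+x. (\<Prod>i<d. ennreal ((normal_ratio s (\<mu> i) (x i))\<^sup>2)) \<partial>PiM {..<d} (\<lambda>_. normal_measure 0 s))"
    unfolding gaussian_zero gaussian_ratio_def
    by (intro nn_integral_cong) (simp add: prod_power_distrib prod_ennreal)
  also have "\<dots> = (\<Prod>i<d. ennreal (exp ((\<mu> i)\<^sup>2 / s\<^sup>2)))"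
    by (subst Q.product_nn_integral_prod) (auto simp: nn_integral_normal_ratio_square[OF s])
  also have "\<dots> = ennreal (exp (\<Sum>i<d. (\<mu> i)\<^sup>2 / s\<^sup>2))"
    by (simp add: prod_ennreal exp_sum)
  also have "(\<Sum>i<d. (\<mu> i)\<^sup>2 / s\<^sup>2) = (l2_norm d \<mu> / s)\<^sup>2"
    by (simp add: l2_norm_def L2_set_def sum_divide_distrib[symmetric] power_divide sum_nonneg)
  finally show ?thesis .
qed

definition reflect :: "nat \<Rightarrow> point \<Rightarrow> point \<Rightarrow> point" where
  "reflect d \<mu> x = (\<lambda>i\<in>{..<d}. \<mu> i - x i)"

lemma measurable_reflect[measurable]: "reflect d \<mu> \<in> point_space d \<rightarrow>\<^sub>M point_space d"
  unfolding reflect_def by measurable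

text \<open>Reflection at \<open>\<mu> / 2\<close> exchanges the means 0 and \<open>\<mu>\<close>,
  hence numerator and denominator of the likelihood ratio.\<close>

lemma gaussian_ratio_reflect: "gaussian_ratio d s \<mu> (reflect d \<mu> x) = 1 / gaussian_ratio d s \<mu> x"
proof -
  have "normal_ratio s m (m - y) = inverse (normal_ratio s m y)" for m y
  proof -
    have "(2 * (m - y) * m - m\<^sup>2) / (2 * s\<^sup>2) = - ((2 * y * m - m\<^sup>2) / (2 * s\<^sup>2))"
      unfolding minus_divide_left by (simp add: power2_eq_square algebra_simps)
    then show ?thesis by (simp add: normal_ratio_def exp_minus)
  qed
  then show ?thesis
    by (simp add: gaussian_ratio_def reflect_def prod_inversef[symmetric] inverse_eq_divide prod_dividef)
qed

text \<open>The reflection acts on each coordinate separately, so preimages of rectangles are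
  rectangles and the one-dimensional case applies to every side.\<close>

lemma distr_gaussian_reflect:
  assumes s: "0 < s"
  shows "distr (gaussian d s \<mu>) (point_space d) (reflect d \<mu>) = gaussian d s (\<lambda>i\<in>{..<d}. 0)"
proof -
  interpret P: product_sigma_finite "\<lambda>i. normal_measure (\<mu> i) s"
    using prob_space_normal_measure[OF s] by (simp add: product_sigma_finite_def prob_space_imp_sigma_finite)
  interpret Q: product_sigma_finite "\<lambda>_::nat. normal_measure 0 s"
    using prob_space_normal_measure[OF s] by (simp add: product_sigma_finite_def prob_space_imp_sigma_finite)
  note sets_gaussian[measurable_cong]
  have sp: "space (gaussian d s \<mu>) = space (point_space d)"
    by (rule sets_eq_imp_space_eq[OF sets_gaussian])
  show ?thesis
    unfolding gaussian_zero
  proof (rule Q.PiM_eqI)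
    show "sets (distr (gaussian d s \<mu>) (point_space d) (reflect d \<mu>)) = sets (PiM {..<d} (\<lambda>_. normal_measure 0 s))"
      unfolding sets_distr by (intro sets_PiM_cong) auto
    fix A assume "\<And>i. i \<in> {..<d} \<Longrightarrow> A i \<in> sets (normal_measure 0 s)"
    then have A: "\<And>i. i < d \<Longrightarrow> A i \<in> sets borel" by auto
    then have B: "(\<lambda>x. \<mu> i - x) -` A i \<in> sets borel" if "i < d" for i
      using measurable_sets[of "\<lambda>x. \<mu> i - x" borel borel "A i"] that by simp
    have "emeasure (distr (gaussian d s \<mu>) (point_space d) (reflect d \<mu>)) (Pi\<^sub>E {..<d} A)
        = emeasure (gaussian d s \<mu>) (reflect d \<mu> -` Pi\<^sub>E {..<d} A \<inter> space (gaussian d s \<mu>))"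
      using A by (intro emeasure_distr sets_PiM_I_finite) auto
    also have "reflect d \<mu> -` Pi\<^sub>E {..<d} A \<inter> space (gaussian d s \<mu>) = (\<Pi>\<^sub>E i\<in>{..<d}. (\<lambda>x. \<mu> i - x) -` A i)"
      unfolding sp by (auto simp: reflect_def space_PiM PiE_iff)
    also have "emeasure (gaussian d s \<mu>) \<dots> = (\<Prod>i<d. emeasure (normal_measure (\<mu> i) s) ((\<lambda>x. \<mu> i - x) -` A i))"
      unfolding gaussian_def using B by (intro P.emeasure_PiM) auto
    also have "\<dots> = (\<Prod>i<d. emeasure (normal_measure 0 s) (A i))"
      using A by (intro prod.cong refl)
        (subst distr_normal_measure_reflect[OF s, symmetric], subst emeasure_distr, auto)
    finally show "emeasure (distr (gaussian d s \<mu>) (point_space d) (reflect d \<mu>)) (Pi\<^sub>E {..<d} A)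
        = (\<Prod>i\<in>{..<d}. emeasure (normal_measure 0 s) (A i))" .
  qed simp
qed

text \<open>Points are extensional, so two of them differ exactly if one of finitely many real
  coordinates does. This supplies the diagonal condition of the general coupling lemmas.\<close>

lemma pred_point_space_neq:
  "Measurable.pred (point_space d \<Otimes>\<^sub>M point_space d) (\<lambda>(x, y). y \<noteq> x)"
proof -
  have "(\<lambda>(x, y). y \<noteq> x) p \<longleftrightarrow> (\<exists>i\<in>{..<d}. snd p i \<noteq> fst p i)"
    if "p \<in> space (point_space d \<Otimes>\<^sub>M point_space d)" for p
  proof -
    have "snd p \<in> extensional {..<d}" "fst p \<in> extensional {..<d}"
      using that by (auto simp: space_pair_measure space_PiM PiE_def)
    then have "snd p = fst p \<longleftrightarrow> (\<forall>i\<in>{..<d}. snd p i = fst p i)"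
      by (metis extensionalityI)
    then show ?thesis by (simp add: case_prod_beta)
  qed
  then have "?thesis \<longleftrightarrow> Measurable.pred (point_space d \<Otimes>\<^sub>M point_space d) (\<lambda>p. \<exists>i\<in>{..<d}. snd p i \<noteq> fst p i)"
    by (rule measurable_cong)
  also have \<dots>
  proof (intro pred_intros_finite finite_lessThan)
    fix i assume "i \<in> {..<d}"
    then have "(\<lambda>p. snd p i) \<in> borel_measurable (point_space d \<Otimes>\<^sub>M point_space d)"
      "(\<lambda>p. fst p i) \<in> borel_measurable (point_space d \<Otimes>\<^sub>M point_space d)" by measurable
    then show "Measurable.pred (point_space d \<Otimes>\<^sub>M point_space d) (\<lambda>p. snd p i \<noteq> fst p i)"
      by measurable
  qed
  finally show ?thesis .
qed

subsection \<open>The lower bound on the type II error\<close>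

text \<open>Flipping all signs puts the negative of \<open>\<theta>\<close> into \<open>K\<close>;
  the scaled point lies on the segment between the two, with weights \<open>(1 + c) / 2\<close> and
  \<open>(1 - c) / 2\<close>.\<close>

lemma qco_shrink:
  assumes K: "qco d K" and \<theta>: "\<theta> \<in> K" and c: "0 \<le> c" "c \<le> 1"
  shows "(\<lambda>i\<in>{..<d}. c * \<theta> i) \<in> K"
proof -
  have neg: "(\<lambda>i\<in>{..<d}. (-1) * \<theta> i) \<in> K"
    using K \<theta> unfolding qco_def by (auto elim!: ballE[of _ _ \<theta>] elim: allE[of _ "\<lambda>_. -1"])
  have conv: "convex_pts d K" using K by (simp add: qco_def)
  have "(\<lambda>i\<in>{..<d}. ((1 + c) / 2) * \<theta> i + ((1 - c) / 2) * (\<lambda>i\<in>{..<d}. (-1) * \<theta> i) i) \<in> K"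
    using conv[unfolded convex_pts_def, rule_format, OF \<theta> neg, of "(1 + c) / 2" "(1 - c) / 2"] c
    by (simp add: add_divide_distrib[symmetric])
  also have "(\<lambda>i\<in>{..<d}. ((1 + c) / 2) * \<theta> i + ((1 - c) / 2) * (\<lambda>i\<in>{..<d}. (-1) * \<theta> i) i)
      = (\<lambda>i\<in>{..<d}. c * \<theta> i)"
    by (auto simp: fun_eq_iff field_simps)
  finally show ?thesis .
qed

lemma l2_norm_scale: "0 \<le> c \<Longrightarrow> l2_norm d (\<lambda>i\<in>{..<d}. c * \<theta> i) = c * l2_norm d \<theta>"
proof -
  assume "0 \<le> c"
  have "l2_norm d (\<lambda>i\<in>{..<d}. c * \<theta> i) = L2_set (\<lambda>i. c * \<theta> i) {..<d}"
    unfolding l2_norm_def by (intro L2_set_cong) auto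
  also have "\<dots> = c * l2_norm d \<theta>"
    using \<open>0 \<le> c\<close> by (simp add: l2_norm_def L2_set_right_distrib)
  finally show ?thesis .
qed

text \<open>The alternative only bounds norms from below, whereas the adversary needs a mean close
  to 0. Shrinking a member yields the smallest possible norm, which is 0 if \<open>\<rho>\<close> is
  negative.\<close>

lemma alternative_norm_eq:
  assumes K: "qco d K" and ne: "alternative d K \<rho> \<noteq> {}"
  obtains \<mu> where "\<mu> \<in> alternative d K \<rho>" "l2_norm d \<mu> = max 0 \<rho>"
proof -
  obtain \<theta> where \<theta>: "\<theta> \<in> K" "\<rho> \<le> l2_norm d \<theta>" using ne by (auto simp: alternative_def)
  have n0: "0 \<le> l2_norm d \<theta>" by (simp add: l2_norm_def)
  \<comment> \<open>If \<open>\<theta>\<close> has norm 0, then \<open>\<rho>\<close> is at most 0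
    and division by zero gives \<open>c = 0\<close>, which is still the right factor.\<close>
  define c where "c = max 0 \<rho> / l2_norm d \<theta>"
  have c: "0 \<le> c" "c \<le> 1" using n0 \<theta>(2) by (auto simp: c_def divide_le_eq)
  have "l2_norm d (\<lambda>i\<in>{..<d}. c * \<theta> i) = max 0 \<rho>"
    using \<theta>(2) n0 by (subst l2_norm_scale[OF c(1)]) (auto simp: c_def)
  moreover from this have "(\<lambda>i\<in>{..<d}. c * \<theta> i) \<in> alternative d K \<rho>"
    using qco_shrink[OF K \<theta>(1) c] by (simp add: alternative_def)
  ultimately show thesis by (rule that[rotated])
qed

text \<open>With \<open>u\<close> for the square of \<open>t\<close>, the bound
  \<open>exp u \<le> 1 + u + u * u\<close> on the unit interval is combined with
  \<open>u * u \<le> u\<close>.\<close>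

lemma exp_square_le: "0 \<le> t \<Longrightarrow> t \<le> 1 \<Longrightarrow> exp (t\<^sup>2) - 1 \<le> 2 * (t::real)\<^sup>2"
  using exp_bound[of "t\<^sup>2"] power_le_one[of t 2] mult_left_le[of "t\<^sup>2" "t\<^sup>2"]
  unfolding power2_eq_square[of "t\<^sup>2"] by simp

section \<open>Admissible adversaries: the identity and the truncated coupling\<close>

lemma data_space_eq: "data_space N d = PiM {..<N} (\<lambda>_. point_space d)"
  by (simp add: data_space_def)

text \<open>Leaving the data alone is allowed, so the level of a test also controls it on clean null
  data.\<close>

lemma return_in_adversaries:
  assumes \<epsilon>: "0 \<le> \<epsilon>"
  shows "return (data_space N d) \<in> adversaries N d \<epsilon>"
  unfolding adversaries_def
proof (intro CollectI conjI ballI)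
  show "return (data_space N d) \<in> data_space N d \<rightarrow>\<^sub>M prob_algebra (data_space N d)"
    by (intro measurable_prob_algebraI prob_space_return return_measurable)
  fix x assume x: "x \<in> space (data_space N d)"
  have "Measurable.pred (data_space N d) (\<lambda>y. real (card {j \<in> {..<N}. y j \<noteq> x j}) \<le> \<epsilon> * real N)"
    unfolding pred_def data_space_eq
    by (rule sets_few_changes[OF pred_point_space_neq x[unfolded data_space_eq]])
  from AE_return[OF x this] \<epsilon>
  show "AE y in return (data_space N d) x. real (card {j \<in> {..<N}. y j \<noteq> x j}) \<le> \<epsilon> * real N"
    by simp
qed

text \<open>The reflection coupling changes each sample with probability at most
  \<open>3 * t / 2\<close>. With a budget of \<open>\<epsilon> * N\<close> changes, the sample size
  cancels in the failure probability given by \<open>contamination_bound\<close>.\<close>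

lemma gaussian_adversary:
  assumes s: "0 < s" and N: "1 \<le> N" and \<epsilon>: "0 < \<epsilon>" and t: "0 < t" "t \<le> 1" "l2_norm d \<mu> \<le> t * s"
    and A: "A \<in> sets (data_space N d)"
  obtains C where "C \<in> adversaries N d \<epsilon>"
    "emeasure (sample_law N d s (\<lambda>i\<in>{..<d}. 0)) A
      \<le> emeasure (observed_law N d s \<mu> C) A + ennreal (3 * t / (2 * \<epsilon>))"
proof -
  let ?S = "point_space d" and ?P = "gaussian d s \<mu>" and ?Q = "gaussian d s (\<lambda>i\<in>{..<d}. 0)"
  let ?r = "gaussian_ratio d s \<mu>"
  let ?k = "flip_kernel ?S (\<lambda>x. min 1 (1 / ?r x)) (reflect d \<mu>)"
  let ?m = "\<epsilon> * real N" and ?\<delta> = "3 * t / 2"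
  note PA = gaussian_in_prob_algebra[OF s, of d \<mu>]
  have k: "?k \<in> ?S \<rightarrow>\<^sub>M prob_algebra ?S"
    by (intro measurable_flip_kernel) (auto simp: less_imp_le[OF gaussian_ratio_pos])
  have PQ: "?P \<bind> ?k = ?Q"
    by (rule bind_flip_kernel[OF sets_gaussian gaussian_eq_density[OF s] prob_space_gaussian[OF s]
          measurable_reflect distr_gaussian_reflect[OF s]])
       (auto simp: gaussian_ratio_pos gaussian_ratio_reflect)
  have D: "{y \<in> space ?S. y \<noteq> x} \<in> sets ?S" if "x \<in> space ?S" for x
  proof -
    have "Measurable.pred ?S (\<lambda>y. y \<noteq> x)"
      using measurable_compose[OF measurable_Pair1'[OF that] pred_point_space_neq] by simp
    then show ?thesis by (simp add: pred_def)
  qed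
  have "(\<integral>\<^sup>+x. emeasure (?k x) {y \<in> space ?S. y \<noteq> x} \<partial>?P)
      \<le> ennreal ((exp ((l2_norm d \<mu> / s)\<^sup>2) - 1) / (2 * t) + t / 2)"
    by (rule nn_integral_flip_kernel_changed[OF sets_gaussian prob_space_gaussian[OF s]
          gaussian_eq_density[OF s] prob_space_gaussian[OF s] measurable_reflect
          measurable_gaussian_ratio gaussian_ratio_pos D t(1) nn_integral_gaussian_ratio_square[OF s]]) auto
  \<comment> \<open>The chi-square divergence is at most twice the square of \<open>t\<close>. Using
    \<open>t\<close> itself as the balancing parameter, the two terms become \<open>t\<close> and
    \<open>t / 2\<close>.\<close>
  also have "\<dots> \<le> ennreal ?\<delta>"
  proof (rule ennreal_leI)
    have "0 \<le> l2_norm d \<mu>" by (simp add: l2_norm_def)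
    then have "(l2_norm d \<mu> / s)\<^sup>2 \<le> t\<^sup>2"
      using s t by (intro power_mono) (auto simp: divide_le_eq)
    then have "exp ((l2_norm d \<mu> / s)\<^sup>2) - 1 \<le> 2 * t\<^sup>2"
      using exp_square_le[of t] t exp_le_cancel_iff[of "(l2_norm d \<mu> / s)\<^sup>2" "t\<^sup>2"] by linarith
    then have "(exp ((l2_norm d \<mu> / s)\<^sup>2) - 1) / (2 * t) \<le> 2 * t\<^sup>2 / (2 * t)"
      using t by (intro divide_right_mono) auto
    moreover have "2 * t\<^sup>2 / (2 * t) = t" using t by (simp add: power2_eq_square)
    ultimately show "(exp ((l2_norm d \<mu> / s)\<^sup>2) - 1) / (2 * t) + t / 2 \<le> ?\<delta>" by linarith
  qed
  finally have \<delta>: "(\<integral>\<^sup>+x. emeasure (?k x) {y \<in> space ?S. y \<noteq> x} \<partial>?P) \<le> ennreal ?\<delta>" .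
  define C where "C = (\<lambda>x. distr (PiM {..<N} (\<lambda>j. ?k (x j))) (data_space N d) (truncate_changes N ?m x))"
  have m: "0 < ?m" using N \<epsilon> by simp
  note bound = contamination_bound[OF PA k pred_point_space_neq \<delta> _ m A[unfolded data_space_eq],
      folded data_space_eq, folded C_def]
  have "0 \<le> ?\<delta>" using t by simp
  note bound = bound[OF this]
  have "C \<in> adversaries N d \<epsilon>"
    unfolding adversaries_def
  proof (intro CollectI conjI ballI)
    show "C \<in> data_space N d \<rightarrow>\<^sub>M prob_algebra (data_space N d)" by (rule bound(1))
    fix x assume x: "x \<in> space (data_space N d)"
    have Tx: "truncate_changes N ?m x \<in> PiM {..<N} (\<lambda>j. ?k (x j)) \<rightarrow>\<^sub>M data_space N d"
    proof -
      have "truncate_changes N ?m x \<in> data_space N d \<rightarrow>\<^sub>M data_space N d"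
        using measurable_compose[OF measurable_Pair1'[OF x]
            measurable_truncate_changes[OF pred_point_space_neq, of N ?m d, folded data_space_eq]] by simp
      moreover have "sets (PiM {..<N} (\<lambda>j. ?k (x j))) = sets (data_space N d)"
        using prob_algebra_kernelD(2)[OF measurable_PiM_kernel[OF finite_lessThan k, of N]] x
        by (simp add: data_space_eq)
      ultimately show ?thesis by (simp cong: measurable_cong_sets)
    qed
    have meas: "{y \<in> space (data_space N d). real (card {j \<in> {..<N}. y j \<noteq> x j}) \<le> ?m} \<in> sets (data_space N d)"
      unfolding data_space_eq by (rule sets_few_changes[OF pred_point_space_neq x[unfolded data_space_eq]])
    show "AE y in C x. real (card {j \<in> {..<N}. y j \<noteq> x j}) \<le> ?m"
      unfolding C_def AE_distr_iff[OF Tx meas]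
      by (intro AE_I2 truncate_changes_card less_imp_le m)
  qed
  moreover have "real N * ?\<delta> / ?m = 3 * t / (2 * \<epsilon>)" using N \<epsilon> by (simp add: field_simps)
  then have "emeasure (sample_law N d s (\<lambda>i\<in>{..<d}. 0)) A
      \<le> emeasure (observed_law N d s \<mu> C) A + ennreal (3 * t / (2 * \<epsilon>))"
    using bound(2) by (simp add: sample_law_def observed_law_def PQ)
  ultimately show thesis by (rule that)
qed

text \<open>A test of level \<open>\<alpha>\<close> accepts clean null data with probability at
  least \<open>1 - \<alpha>\<close>. At a mean of norm \<open>max 0 \<rho>\<close> the adversary
  imitates such data, which costs at most \<open>3 * t / (2 * \<epsilon>)\<close>.\<close>

lemma minimax_type2_lower_bound:
  assumes s: "0 < s" and N: "1 \<le> N" and \<epsilon>: "0 < \<epsilon>" and t: "0 < t" "t \<le> 1" "\<rho> \<le> t * s"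
    and K: "qco d K" and ne: "alternative d K \<rho> \<noteq> {}" and \<alpha>: "0 \<le> \<alpha>"
  shows "ennreal (1 - \<alpha> - 3 * t / (2 * \<epsilon>)) \<le> minimax_type2 N d s K \<epsilon> \<alpha> \<rho>"
  unfolding minimax_type2_def
proof (rule INF_greatest)
  fix \<phi> assume \<phi>: "\<phi> \<in> strong_level_tests N d s \<epsilon> \<alpha>"
  let ?D = "data_space N d" and ?Q = "sample_law N d s (\<lambda>i\<in>{..<d}. 0)"
  let ?A = "\<lambda>b. {x \<in> space ?D. \<phi> x = b}"
  obtain \<mu> where \<mu>: "\<mu> \<in> alternative d K \<rho>" "l2_norm d \<mu> = max 0 \<rho>"
    by (rule alternative_norm_eq[OF K ne])
  have \<phi>m: "\<phi> \<in> ?D \<rightarrow>\<^sub>M count_space {0, 1}"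
    using \<phi> by (simp add: strong_level_tests_def tests_def)
  have A: "?A b \<in> sets ?D" if "b \<in> {0, 1}" for b
    using measurable_sets[OF \<phi>m, of "{b}"] that by (simp add: vimage_def Int_def conj_commute)
  have Qs: "sets ?Q = sets ?D" "space ?Q = space ?D"
  proof -
    show "sets ?Q = sets ?D"
      unfolding sample_law_def data_space_eq by (intro sets_PiM_cong sets_gaussian refl)
    then show "space ?Q = space ?D" by (rule sets_eq_imp_space_eq)
  qed
  interpret Q: prob_space ?Q
    unfolding sample_law_def by (intro prob_space_PiM prob_space_gaussian s)
  have "prob_test N d s (\<lambda>i\<in>{..<d}. 0) (return ?D) \<phi> 1
      \<le> (SUP C\<in>adversaries N d \<epsilon>. prob_test N d s (\<lambda>i\<in>{..<d}. 0) C \<phi> 1)"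
    by (rule SUP_upper[OF return_in_adversaries[OF less_imp_le[OF \<epsilon>]]])
  also have "\<dots> \<le> ennreal \<alpha>" using \<phi> by (simp add: strong_level_tests_def)
  finally have "emeasure ?Q (?A 1) \<le> ennreal \<alpha>"
    by (simp add: prob_test_def observed_law_def bind_return''[OF Qs(1)])
  then have "Q.prob (?A 1) \<le> \<alpha>" using \<alpha> by (simp add: Q.emeasure_eq_measure)
  \<comment> \<open>Tests take no values besides 0 and 1, so acceptance is the complement of
    rejection.\<close>
  moreover have "space ?Q - ?A 1 = ?A 0"
  proof (rule set_eqI)
    fix x show "x \<in> space ?Q - ?A 1 \<longleftrightarrow> x \<in> ?A 0"
      using measurable_space[OF \<phi>m, of x] by (cases "x \<in> space ?D") (simp_all add: Qs(2), linarith)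
  qed
  then have "Q.prob (?A 0) = 1 - Q.prob (?A 1)"
    using Q.prob_compl[of "?A 1"] A[of 1] Qs by simp
  ultimately have Q0: "ennreal (1 - \<alpha>) \<le> emeasure ?Q (?A 0)"
    by (simp add: Q.emeasure_eq_measure ennreal_leI)
  have A0: "?A 0 \<in> sets ?D" by (rule A) simp
  have "l2_norm d \<mu> \<le> t * s" using \<mu>(2) t s by simp
  from gaussian_adversary[OF s N \<epsilon> t(1,2) this A0]
  obtain C where C: "C \<in> adversaries N d \<epsilon>"
    "emeasure ?Q (?A 0) \<le> emeasure (observed_law N d s \<mu> C) (?A 0) + ennreal (3 * t / (2 * \<epsilon>))"
    by blast
  \<comment> \<open>Both \<open>ennreal\<close> and its subtraction cut off at 0, so the identity
    holds even if the real difference is negative; the bound is then trivial.\<close>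
  have "ennreal (1 - \<alpha> - 3 * t / (2 * \<epsilon>)) = ennreal (1 - \<alpha>) - ennreal (3 * t / (2 * \<epsilon>))"
    using t \<epsilon> by (subst ennreal_minus) auto
  also have "\<dots> \<le> emeasure (observed_law N d s \<mu> C) (?A 0)"
    using order_trans[OF Q0 C(2)] by (simp add: ennreal_minus_le_iff add.commute)
  also have "\<dots> = prob_test N d s \<mu> C \<phi> 0" by (simp add: prob_test_def)
  also have "\<dots> \<le> (SUP C\<in>adversaries N d \<epsilon>. prob_test N d s \<mu> C \<phi> 0)"
    by (rule SUP_upper[OF C(1)])
  also have "\<dots> \<le> (SUP \<mu>\<in>alternative d K \<rho>. SUP C\<in>adversaries N d \<epsilon>. prob_test N d s \<mu> C \<phi> 0)"
    by (rule SUP_upper[OF \<mu>(1)])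
  finally show "ennreal (1 - \<alpha> - 3 * t / (2 * \<epsilon>)) \<le> \<dots>" .
qed

theorem theorem3p6:
  fixes \<alpha> :: real
  assumes "0 < \<alpha>" and "\<alpha> < 1 / 2"
  shows "\<exists>c1 c2 c3 :: real. 0 < c1 \<and> 0 < c2 \<and> 0 < c3 \<and>
    (\<forall>(N :: nat) (d :: nat) (K :: (nat \<Rightarrow> real) set) (\<sigma> :: real) (c0 :: real) (\<epsilon> :: real) (\<rho> :: real).
       1 \<le> N \<longrightarrow> 1 \<le> d \<longrightarrow> 0 < \<sigma> \<longrightarrow> qco d K \<longrightarrow>
       ereal (\<sigma> / sqrt (real N)) < (SUP \<theta>\<in>K. ereal (l2_norm d \<theta>)) \<longrightarrow>
       0 < c0 \<longrightarrow> c0 < 1 / 2 \<longrightarrow> 0 \<le> \<epsilon> \<longrightarrow> \<epsilon> < c0 \<longrightarrow>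
       alternative d K \<rho> \<noteq> {} \<longrightarrow>
       c1 / sqrt (real N) \<le> \<epsilon> \<longrightarrow> \<rho> \<le> c2 * \<epsilon> * \<sigma> \<longrightarrow>
       ennreal c3 \<le> minimax_type2 N d \<sigma> K \<epsilon> \<alpha> \<rho>)"
\<comment> \<open>The value 1/6 for \<open>c2\<close> leads to \<open>t = \<epsilon> / 6\<close>, so
  imitating the null law costs \<open>3 * t / (2 * \<epsilon>) = 1 / 4\<close>. As
  \<open>\<alpha>\<close> is below 1/2, more than 1/4 remains for \<open>c3\<close>.\<close>
proof (rule exI[of _ 1], rule exI[of _ "1 / 6"], rule exI[of _ "1 / 4"], intro conjI allI impI)
  fix N d :: nat and K :: "(nat \<Rightarrow> real) set" and \<sigma> c0 \<epsilon> \<rho> :: real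
  assume N: "1 \<le> N" and \<sigma>: "0 < \<sigma>" and K: "qco d K" and c0: "c0 < 1 / 2" "\<epsilon> < c0"
    and ne: "alternative d K \<rho> \<noteq> {}" and \<epsilon>: "1 / sqrt (real N) \<le> \<epsilon>" and \<rho>: "\<rho> \<le> 1 / 6 * \<epsilon> * \<sigma>"
  have "0 < 1 / sqrt (real N)" using N by simp
  then have e0: "0 < \<epsilon>" using \<epsilon> by linarith
  define t where "t = \<epsilon> / 6"
  have t: "0 < t" "t \<le> 1" "\<rho> \<le> t * \<sigma>" using e0 c0 \<rho> by (auto simp: t_def)
  have "(1 / 4 :: real) \<le> 1 - \<alpha> - 3 * t / (2 * \<epsilon>)" using e0 assms by (simp add: t_def)
  then have "ennreal (1 / 4) \<le> ennreal (1 - \<alpha> - 3 * t / (2 * \<epsilon>))" by (rule ennreal_leI)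
  also have "\<dots> \<le> minimax_type2 N d \<sigma> K \<epsilon> \<alpha> \<rho>"
    by (rule minimax_type2_lower_bound[OF \<sigma> N e0 t K ne]) (use assms in simp)
  finally show "ennreal (1 / 4) \<le> minimax_type2 N d \<sigma> K \<epsilon> \<alpha> \<rho>" .
qed simp_all

end
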